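(* Let $\xi=(\xi(\tau))_{\tau\in\Theta}$ be a $p$-integrable admissible family and let $V(\nu)=\operatorname{ess\,sup}_{\tau\in\Theta_\nu}\rho_{\nu,\tau}[\xi(\tau)]$ for $\nu\in\Theta$. Assume that $V(\nu)\in L^p$ for every $\nu\in\Theta$. If $\rho$ satisfies knowledge preservation, monotonicity, consistency, the generalized zero-one law and the monotone Fatou property with respect to the terminal condition, then $V$ satisfies the Dynamic Programming Principle: $$\text{for each }k\in\mathbb N,\quad V(\theta_k)=\max\big(\xi(\theta_k),\,\rho_{\theta_k,\theta_{k+1}}[V(\theta_{k+1})]\big)\ \text{a.s.},\qquad\text{and } V(T)=\xi(T)\ \text{a.s.}$$
   Context: Setting. $T>0$ is fixed; $(\Omega,\mathcal F,P)$ is a complete probability space with a right-continuous complete filtration $(\mathcal F_t)_{t\in[0,T]}$. Equalities and inequalities between random variables (and between measurable sets) are understood $P$-a.s. $\mathbb N=\{0,1,2,\dots\}$. $(\theta_k)_{k\in\mathbb N}$ is a sequence of stopping times with $\theta_0=0$, $\theta_k\le\theta_{k+1}$ a.s. for all $k$, and $\lim_{k}\theta_k=T$ a.s. $\Theta$ is the set of stopping times of the form $\tau=\sum_{k=0}^{\infty}\theta_k\mathbf 1_{A_k}+T\mathbf 1_{\bar A}$, where $\{(A_k)_{k\in\mathbb N},\bar A\}$ is a partition of $\Omega$ with $A_k\in\mathcal F_{\theta_k}$ for each $k$ and $\bar A\in\mathcal F_T$. For $\tau\in\Theta$, $\Theta_\tau=\{\nu\in\Theta:\nu\ge\tau \text{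 a.s.}\}$. $p\in[1,+\infty]$ is fixed. Families. A family $\phi=(\phi(\tau))_{\tau\in\Theta}$ is admissible if each $\phi(\tau)$ is a real-valued $\mathcal F_\tau$-measurable random variable and $\phi(\tau)=\phi(\tau')$ a.s. on $\{\tau=\tau'\}$ for all $\tau,\tau'\in\Theta$; it is $p$-integrable if $\phi(\tau)\in L^p$ for all $\tau\in\Theta$. Operators. $\rho=(\rho_{S,\tau})_{S,\tau\in\Theta}$ is a family of (possibly non-linear) operators $\rho_{S,\tau}:L^p(\mathcal F_\tau)\to L^p(\mathcal F_S)$. Properties: - knowledge preservation: $\rho_{\tau,S}[\eta]=\eta$ for all $S\in\Theta$, $\tau\in\Theta_S$, $\eta\in L^p(\mathcal F_S)$; - monotonicity: $\rho_{S,\tau}[\eta_1]\le\rho_{S,\tau}[\eta_2]$ a.s. whenever $\eta_1\le\eta_2$ a.s., $\eta_1,\eta_2\in L^p(\mathcal F_\tau)$; - consistency: $\rho_{S,\theta}[\rho_{\theta,\tau}[\eta]]=\rho_{S,\tau}[\eta]$ for all $S,\theta,\tau\in\Theta$ with $S\le\theta\le\tau$ a.s. and $\eta\in L^p(\mathcal F_\tau)$; - generalized zero-one law: $\mathbf 1_A\rho_{S,\tau}[\zeta(\tau)]=\mathbf 1_A\rho_{S,\tau'}[\zeta(\tau')]$ for every $p$-integrable admissible family $\zeta$, $S\in\Theta$, $A\in\mathcal F_S$, and $\tau,\tau'\in\Theta_S$ with $\tau=\tau'$ on $A$; - monotone Fatou property with respect to the terminal condition: $\rho_{S,\tau}[\eta]\le\liminf_n\rho_{S,\tau}[\eta_n]$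 whenever $(\eta_n)\subset L^p(\mathcal F_\tau)$ is non-decreasing, $\sup_n\eta_n\in L^p$ and $\lim_n\eta_n=\eta$ a.s. *)

theory Defs
  imports "HOL-Probability.Probability" "HOL-Probability.Stopping_Time"
    "HOL-Probability.Essential_Supremum"
begin

text \<open>
  Essential supremum of a family of random variables (as opposed to the essential supremum
  of a single function in the library): the almost surely least almost sure upper bound.
  It is determined only up to a null set, hence a predicate.
\<close>

definition is_ess_sup :: "'a measure \<Rightarrow> ('a \<Rightarrow> ereal) set \<Rightarrow> ('a \<Rightarrow> ereal) \<Rightarrow> bool" where
  "is_ess_sup M \<X> Y \<longleftrightarrow>
     Y \<in> borel_measurable M \<and>
     (\<forall>X\<in>\<X>. AE \<omega> in M. X \<omega> \<le> Y \<omega>) \<and>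
     (\<forall>Z\<in>borel_measurable M. (\<forall>X\<in>\<X>. AE \<omega> in M. X \<omega> \<le> Z \<omega>) \<longrightarrow> (AE \<omega> in M. Y \<omega> \<le> Z \<omega>))"

text \<open>
  The library's filtrations are indexed by a whole type. Only the part of \<open>F\<close> indexed by
  \<open>[0,T]\<close> matters here: every filtration on \<open>[0,T]\<close> extends to the reals (constantly on both
  sides), and for stopping times with values in \<open>[0,T]\<close> neither the stopping time
  property nor the \<open>\<sigma>\<close>-algebra \<^term>\<open>filtration.pre_sigma\<close> depends on the extension.
\<close>

locale bermudan =
  prob_space M + complete_measure M + filtration "space M" F
  for M :: "'a measure" and F :: "real \<Rightarrow> 'a measure" +
  fixes T :: real and \<theta> :: "nat \<Rightarrow> 'a \<Rightarrow> real" and p :: ennreal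
  assumes T_pos: "0 < T"
    and F_subset: "\<And>t. t \<in> {0..T} \<Longrightarrow> sets (F t) \<subseteq> sets M"
    and F_right_continuous: "\<And>t. t \<in> {0..<T} \<Longrightarrow> sets (F t) = (\<Inter>s\<in>{t<..T}. sets (F s))"
    and F_complete: "null_sets M \<subseteq> sets (F 0)"
    and stopping_theta: "\<And>k. stopping_time F (\<theta> k)"
    and theta_range: "\<And>k \<omega>. \<omega> \<in> space M \<Longrightarrow> \<theta> k \<omega> \<in> {0..T}"
    and theta_0: "AE \<omega> in M. \<theta> 0 \<omega> = 0"
    and theta_mono: "\<And>k. AE \<omega> in M. \<theta> k \<omega> \<le> \<theta> (Suc k) \<omega>"
    and theta_lim: "AE \<omega> in M. (\<lambda>k. \<theta> k \<omega>) \<longlonglongrightarrow> T"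
    and p_ge_1: "1 \<le> p"
begin

definition Theta :: "('a \<Rightarrow> real) set" where
  "Theta = {\<tau>. stopping_time F \<tau> \<and> (\<forall>\<omega>\<in>space M. \<tau> \<omega> \<in> {0..T}) \<and>
     (\<exists>A B. (\<forall>k. A k \<in> sets (pre_sigma (\<theta> k))) \<and> B \<in> sets (F T) \<and>
        disjoint_family A \<and> (\<forall>k. A k \<inter> B = {}) \<and> (\<Union>k. A k) \<union> B = space M \<and>
        (AE \<omega> in M. \<tau> \<omega> = (\<Sum>k. \<theta> k \<omega> * indicator (A k) \<omega>) + T * indicator B \<omega>))}"

definition Theta_from :: "('a \<Rightarrow> real) \<Rightarrow> ('a \<Rightarrow> real) set" where
  "Theta_from \<tau> = {\<nu>\<in>Theta. AE \<omega> in M. \<tau> \<omega> \<le> \<nu> \<omega>}"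

text \<open>
  \<open>Lp G\<close> consists of the \<open>G\<close>-measurable functions (not equivalence classes) that are
  \<open>p\<close>-integrable with respect to the probability measure \<open>M\<close>; \<open>G\<close> serves only as a
  \<open>\<sigma>\<close>-algebra, since the library's \<^term>\<open>pre_sigma\<close> carries the zero measure.
\<close>

definition Lp :: "'a measure \<Rightarrow> ('a \<Rightarrow> real) set" where
  "Lp G = {\<eta>\<in>borel_measurable G.
     if p = \<infinity> then esssup M (\<lambda>\<omega>. ereal \<bar>\<eta> \<omega>\<bar>) < \<infinity>
     else integrable M (\<lambda>\<omega>. \<bar>\<eta> \<omega>\<bar> powr enn2real p)}"

definition admissible :: "(('a \<Rightarrow> real) \<Rightarrow> 'a \<Rightarrow> real) \<Rightarrow> bool" where
  "admissible \<phi> \<longleftrightarrow>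
     (\<forall>\<tau>\<in>Theta. \<phi> \<tau> \<in> borel_measurable (pre_sigma \<tau>)) \<and>
     (\<forall>\<tau>\<in>Theta. \<forall>\<tau>'\<in>Theta. AE \<omega> in M. \<tau> \<omega> = \<tau>' \<omega> \<longrightarrow> \<phi> \<tau> \<omega> = \<phi> \<tau>' \<omega>)"

definition p_integrable :: "(('a \<Rightarrow> real) \<Rightarrow> 'a \<Rightarrow> real) \<Rightarrow> bool" where
  "p_integrable \<phi> \<longleftrightarrow> (\<forall>\<tau>\<in>Theta. \<phi> \<tau> \<in> Lp M)"

text \<open>
  The second clause says that \<open>\<rho> S \<tau>\<close> is well defined on almost sure equivalence classes.
\<close>

definition operator_family ::
    "(('a \<Rightarrow> real) \<Rightarrow> ('a \<Rightarrow> real) \<Rightarrow> ('a \<Rightarrow> real) \<Rightarrow> 'a \<Rightarrow> real) \<Rightarrow> bool" where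
  "operator_family \<rho> \<longleftrightarrow> (\<forall>S\<in>Theta. \<forall>\<tau>\<in>Theta.
     (\<forall>\<eta>\<in>Lp (pre_sigma \<tau>). \<rho> S \<tau> \<eta> \<in> Lp (pre_sigma S)) \<and>
     (\<forall>\<eta>1\<in>Lp (pre_sigma \<tau>). \<forall>\<eta>2\<in>Lp (pre_sigma \<tau>).
        (AE \<omega> in M. \<eta>1 \<omega> = \<eta>2 \<omega>) \<longrightarrow> (AE \<omega> in M. \<rho> S \<tau> \<eta>1 \<omega> = \<rho> S \<tau> \<eta>2 \<omega>)))"

definition knowledge_preserving ::
    "(('a \<Rightarrow> real) \<Rightarrow> ('a \<Rightarrow> real) \<Rightarrow> ('a \<Rightarrow> real) \<Rightarrow> 'a \<Rightarrow> real) \<Rightarrow> bool" where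
  "knowledge_preserving \<rho> \<longleftrightarrow> (\<forall>S\<in>Theta. \<forall>\<tau>\<in>Theta_from S. \<forall>\<eta>\<in>Lp (pre_sigma S).
     AE \<omega> in M. \<rho> \<tau> S \<eta> \<omega> = \<eta> \<omega>)"

definition monotone_op ::
    "(('a \<Rightarrow> real) \<Rightarrow> ('a \<Rightarrow> real) \<Rightarrow> ('a \<Rightarrow> real) \<Rightarrow> 'a \<Rightarrow> real) \<Rightarrow> bool" where
  "monotone_op \<rho> \<longleftrightarrow> (\<forall>S\<in>Theta. \<forall>\<tau>\<in>Theta.
     \<forall>\<eta>1\<in>Lp (pre_sigma \<tau>). \<forall>\<eta>2\<in>Lp (pre_sigma \<tau>).
       (AE \<omega> in M. \<eta>1 \<omega> \<le> \<eta>2 \<omega>) \<longrightarrow> (AE \<omega> in M. \<rho> S \<tau> \<eta>1 \<omega> \<le> \<rho> S \<tau> \<eta>2 \<omega>))"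

definition consistent ::
    "(('a \<Rightarrow> real) \<Rightarrow> ('a \<Rightarrow> real) \<Rightarrow> ('a \<Rightarrow> real) \<Rightarrow> 'a \<Rightarrow> real) \<Rightarrow> bool" where
  "consistent \<rho> \<longleftrightarrow> (\<forall>S\<in>Theta. \<forall>\<nu>\<in>Theta_from S. \<forall>\<tau>\<in>Theta_from \<nu>. \<forall>\<eta>\<in>Lp (pre_sigma \<tau>).
     AE \<omega> in M. \<rho> S \<nu> (\<rho> \<nu> \<tau> \<eta>) \<omega> = \<rho> S \<tau> \<eta> \<omega>)"

definition zero_one_law ::
    "(('a \<Rightarrow> real) \<Rightarrow> ('a \<Rightarrow> real) \<Rightarrow> ('a \<Rightarrow> real) \<Rightarrow> 'a \<Rightarrow> real) \<Rightarrow> bool" where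
  "zero_one_law \<rho> \<longleftrightarrow> (\<forall>\<zeta>. admissible \<zeta> \<and> p_integrable \<zeta> \<longrightarrow>
     (\<forall>S\<in>Theta. \<forall>A\<in>sets (pre_sigma S). \<forall>\<tau>\<in>Theta_from S. \<forall>\<tau>'\<in>Theta_from S.
       (AE \<omega> in M. \<omega> \<in> A \<longrightarrow> \<tau> \<omega> = \<tau>' \<omega>) \<longrightarrow>
       (AE \<omega> in M. indicator A \<omega> * \<rho> S \<tau> (\<zeta> \<tau>) \<omega> = indicator A \<omega> * \<rho> S \<tau>' (\<zeta> \<tau>') \<omega>)))"

text \<open>
  The limit inferior is taken in the extended reals. The real supremum below agrees almost
  surely with the extended real one, as the sequence converges to a real limit.
\<close>

definition monotone_Fatou ::
    "(('a \<Rightarrow> real) \<Rightarrow> ('a \<Rightarrow> real) \<Rightarrow> ('a \<Rightarrow> real) \<Rightarrow> 'a \<Rightarrow> real) \<Rightarrow> bool" where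
  "monotone_Fatou \<rho> \<longleftrightarrow> (\<forall>S\<in>Theta. \<forall>\<tau>\<in>Theta. \<forall>\<eta>\<in>Lp (pre_sigma \<tau>). \<forall>\<eta>s.
     (\<forall>n. \<eta>s n \<in> Lp (pre_sigma \<tau>)) \<and>
     (\<forall>n. AE \<omega> in M. \<eta>s n \<omega> \<le> \<eta>s (Suc n) \<omega>) \<and>
     (\<lambda>\<omega>. SUP n. \<eta>s n \<omega>) \<in> Lp M \<and>
     (AE \<omega> in M. (\<lambda>n. \<eta>s n \<omega>) \<longlonglongrightarrow> \<eta> \<omega>) \<longrightarrow>
     (AE \<omega> in M. ereal (\<rho> S \<tau> \<eta> \<omega>) \<le> liminf (\<lambda>n. ereal (\<rho> S \<tau> (\<eta>s n) \<omega>))))"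

text \<open>
  \<open>V\<close> is any choice of versions of the essential suprema. Being real-valued is no restriction
  for families that are integrable.
\<close>

definition is_value_family ::
    "(('a \<Rightarrow> real) \<Rightarrow> ('a \<Rightarrow> real) \<Rightarrow> ('a \<Rightarrow> real) \<Rightarrow> 'a \<Rightarrow> real) \<Rightarrow>
     (('a \<Rightarrow> real) \<Rightarrow> 'a \<Rightarrow> real) \<Rightarrow> (('a \<Rightarrow> real) \<Rightarrow> 'a \<Rightarrow> real) \<Rightarrow> bool" where
  "is_value_family \<rho> \<xi> V \<longleftrightarrow> (\<forall>\<nu>\<in>Theta.
     is_ess_sup M {\<lambda>\<omega>. ereal (\<rho> \<nu> \<tau> (\<xi> \<tau>) \<omega>) | \<tau>. \<tau> \<in> Theta_from \<nu>} (\<lambda>\<omega>. ereal (V \<nu> \<omega>)))"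

end

end

theory Submission
  imports Defs
begin

text \<open>
  The family \<open>\<rho>\<^bsub>\<nu>,\<tau>\<^esub>[\<xi>(\<tau>)]\<close>, \<open>\<tau> \<in> \<Theta>\<^sub>\<nu>\<close>, is upward directed: pasting two stopping times along
  a set of \<open>\<F>\<^sub>\<nu>\<close> realises the maximum, by the zero-one law. Hence \<open>V(\<nu>)\<close> is the limit of a
  non-decreasing sequence from the family, and the Fatou property with consistency gives
  \<open>\<rho>[V(\<theta>\<^bsub>k+1\<^esub>)] \<le> V(\<theta>\<^sub>k)\<close>. Conversely, \<open>\<tau> \<in> \<Theta>\<close> with \<open>\<tau> \<ge> \<theta>\<^sub>k\<close> is at least \<open>\<theta>\<^bsub>k+1\<^esub>\<close>
  outside \<open>{\<tau> = \<theta>\<^sub>k}\<close>, so there \<open>\<tau>\<close> may be replaced by \<open>max \<tau> \<theta>\<^bsub>k+1\<^esub>\<close>.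
\<close>

section \<open>Essential suprema of upward directed families\<close>

lemma is_ess_sup_upper: "is_ess_sup M \<X> Y \<Longrightarrow> X \<in> \<X> \<Longrightarrow> AE \<omega> in M. X \<omega> \<le> Y \<omega>"
  by (simp add: is_ess_sup_def)

lemma is_ess_sup_least:
  assumes "is_ess_sup M \<X> Y" "Z \<in> borel_measurable M" "\<And>X. X \<in> \<X> \<Longrightarrow> AE \<omega> in M. X \<omega> \<le> Z \<omega>"
  shows "AE \<omega> in M. Y \<omega> \<le> Z \<omega>"
  using assms by (simp add: is_ess_sup_def)

text \<open>The sequence maximises the expectation of the bounded, strictly increasing transform \<open>arctan\<close>.\<close>

lemma (in prob_space) directed_ess_sup_sequence:
  fixes f :: "'i \<Rightarrow> 'a \<Rightarrow> real" and Y :: "'a \<Rightarrow> real"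
  assumes ne: "I \<noteq> {}"
    and f [measurable]: "\<And>i. i \<in> I \<Longrightarrow> f i \<in> borel_measurable M"
    and dir: "\<And>i j. i \<in> I \<Longrightarrow> j \<in> I \<Longrightarrow> \<exists>k\<in>I. AE \<omega> in M. max (f i \<omega>) (f j \<omega>) \<le> f k \<omega>"
    and Y: "is_ess_sup M {\<lambda>\<omega>. ereal (f i \<omega>) | i. i \<in> I} (\<lambda>\<omega>. ereal (Y \<omega>))"
  obtains s where "\<And>n::nat. s n \<in> I"
    and "\<And>n. AE \<omega> in M. f (s n) \<omega> \<le> f (s (Suc n)) \<omega>"
    and "AE \<omega> in M. (\<lambda>n. f (s n) \<omega>) \<longlonglongrightarrow> Y \<omega>"
proof -
  have arctan_bound: "\<bar>arctan x\<bar> \<le> pi" for x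
    using arctan_bounded[of x] pi_gt_zero by linarith
  have int: "integrable M (\<lambda>\<omega>. arctan (g \<omega>))" if "g \<in> borel_measurable M" for g :: "'a \<Rightarrow> real"
    by (rule integrable_const_bound[where B=pi]) (use that arctan_bound in auto)
  have f_le_Y: "AE \<omega> in M. f i \<omega> \<le> Y \<omega>" if "i \<in> I" for i
    using Y that unfolding is_ess_sup_def by fastforce
  define e where "e i = (\<integral>\<omega>. arctan (f i \<omega>) \<partial>M)" for i
  have e_mono: "e i \<le> e j" if "i \<in> I" "j \<in> I" "AE \<omega> in M. f i \<omega> \<le> f j \<omega>" for i j
    unfolding e_def using that by (intro integral_mono_AE int f) (auto simp: arctan_le_iff)
  have e_le: "e i \<le> pi" if "i \<in> I" for i
  proof -
    have "e i \<le> (\<integral>\<omega>. pi \<partial>M)"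
      unfolding e_def using that arctan_bound
      by (intro integral_mono int f) (auto simp: abs_le_iff)
    then show ?thesis by (simp add: prob_space)
  qed
  have bdd: "bdd_above (e ` I)"
    using e_le by (auto intro!: bdd_aboveI2[where M=pi])
  define c where "c = Sup (e ` I)"
  have e_le_c: "e i \<le> c" if "i \<in> I" for i
    unfolding c_def using that bdd by (auto intro: cSup_upper)
  have "\<exists>i\<in>I. c - inverse (real (Suc n)) < e i" for n
    using less_cSup_iff[of "e ` I" "c - inverse (real (Suc n))"] ne bdd
    unfolding c_def[symmetric] by auto
  then obtain r where r: "\<And>n. r n \<in> I" "\<And>n. c - inverse (real (Suc n)) < e (r n)"
    by metis
  obtain d where d: "\<And>i j. i \<in> I \<Longrightarrow> j \<in> I \<Longrightarrow> d i j \<in> I"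
    "\<And>i j. i \<in> I \<Longrightarrow> j \<in> I \<Longrightarrow> AE \<omega> in M. max (f i \<omega>) (f j \<omega>) \<le> f (d i j) \<omega>"
    using dir by metis
  \<comment> \<open>\<open>r n\<close> comes within \<open>inverse (real (Suc n))\<close> of the
    supremum \<open>c\<close> of the expectations. Absorbing \<open>r (Suc n)\<close> into
    \<open>s n\<close> by directedness makes the sequence increase a.s. while its expectations still
    tend to \<open>c\<close>.\<close>
  define s where "s = rec_nat (r 0) (\<lambda>n i. d i (r (Suc n)))"
  have s_simps: "s 0 = r 0" "\<And>n. s (Suc n) = d (s n) (r (Suc n))"
    by (simp_all add: s_def)
  have s_in: "s n \<in> I" for n
    by (induction n) (simp_all add: s_simps r d)
  have s_mono: "AE \<omega> in M. f (s n) \<omega> \<le> f (s (Suc n)) \<omega>" for n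
    using d(2)[OF s_in[of n] r(1)[of "Suc n"]] by (auto simp: s_simps)
  have e_r_le: "e (r n) \<le> e (s n)" for n
  proof (cases n)
    case (Suc m)
    show ?thesis
      using d(2)[OF s_in[of m] r(1)[of "Suc m"]] unfolding Suc s_simps
      by (intro e_mono r d s_in) auto
  qed (simp add: s_simps)
  have "(\<lambda>n. c - inverse (real (Suc n))) \<longlonglongrightarrow> c"
    using tendsto_diff[OF tendsto_const LIMSEQ_inverse_real_of_nat, of c] by simp
  then have e_lim: "(\<lambda>n. e (s n)) \<longlonglongrightarrow> c"
    by (rule tendsto_sandwich[OF _ _ _ tendsto_const, rotated 2])
      (intro always_eventually allI e_le_c s_in less_imp_le[OF less_le_trans[OF r(2) e_r_le]])+
  \<comment> \<open>\<open>lim\<close> is unspecified where the sequence diverges, yet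
    \<open>Z\<close> is measurable. The divergence set is null: a.s. the sequence is non-decreasing
    and bounded by the real number \<open>Y \<omega>\<close>.\<close>
  define Z where "Z \<omega> = lim (\<lambda>n. f (s n) \<omega>)" for \<omega>
  have s_meas [measurable]: "f (s n) \<in> borel_measurable M" for n
    by (intro f s_in)
  have Z_meas [measurable]: "Z \<in> borel_measurable M"
    unfolding Z_def by measurable
  have "AE \<omega> in M. \<forall>n. f (s n) \<omega> \<le> f (s (Suc n)) \<omega> \<and> f (s n) \<omega> \<le> Y \<omega>"
    unfolding AE_all_countable using s_mono f_le_Y[OF s_in] by auto
  then have Z_lim: "AE \<omega> in M. (\<lambda>n. f (s n) \<omega>) \<longlonglongrightarrow> Z \<omega>"
  proof eventually_elim
    case (elim \<omega>)
    then have "incseq (\<lambda>n. f (s n) \<omega>)" "\<forall>n. f (s n) \<omega> \<le> Y \<omega>"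
      by (auto simp: incseq_Suc_iff)
    then have "convergent (\<lambda>n. f (s n) \<omega>)"
      by (metis incseq_convergent convergentI)
    then show ?case
      by (simp add: Z_def convergent_LIMSEQ_iff)
  qed
  have e_Z: "(\<integral>\<omega>. arctan (Z \<omega>) \<partial>M) = c"
  proof (rule LIMSEQ_unique[OF _ e_lim])
    show "(\<lambda>n. e (s n)) \<longlonglongrightarrow> (\<integral>\<omega>. arctan (Z \<omega>) \<partial>M)"
      unfolding e_def
      by (rule integral_dominated_convergence[where w="\<lambda>_. pi"])
        (use Z_lim arctan_bound in \<open>auto elim!: eventually_mono intro: tendsto_arctan\<close>)
  qed
  \<comment> \<open>Adding a further member \<open>f i\<close> cannot raise the expectation above
    \<open>c\<close>, because \<open>d (s n) i\<close> is again an index in \<open>I\<close>. Hence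
    \<open>arctan (max (Z \<omega>) (f i \<omega>))\<close> and \<open>arctan (Z \<omega>)\<close>
    have equal expectations and agree a.s.; injectivity of \<open>arctan\<close> then gives the
    bound.\<close>
  have "AE \<omega> in M. f i \<omega> \<le> Z \<omega>" if i: "i \<in> I" for i
  proof -
    have [measurable]: "f i \<in> borel_measurable M" by (rule f[OF i])
    have "(\<integral>\<omega>. arctan (max (Z \<omega>) (f i \<omega>)) \<partial>M) \<le> c"
    proof (rule LIMSEQ_le_const2)
      show "(\<lambda>n. \<integral>\<omega>. arctan (max (f (s n) \<omega>) (f i \<omega>)) \<partial>M)
          \<longlonglongrightarrow> (\<integral>\<omega>. arctan (max (Z \<omega>) (f i \<omega>)) \<partial>M)"
        by (rule integral_dominated_convergence[where w="\<lambda>_. pi"])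
          (use Z_lim arctan_bound in
            \<open>auto elim!: eventually_mono intro!: tendsto_arctan tendsto_max\<close>)
      have "(\<integral>\<omega>. arctan (max (f (s n) \<omega>) (f i \<omega>)) \<partial>M) \<le> e (d (s n) i)" for n
        unfolding e_def using d(2)[OF s_in i]
        by (intro integral_mono_AE int f d s_in i) (auto simp: arctan_le_iff)
      then show "\<exists>N. \<forall>n\<ge>N. (\<integral>\<omega>. arctan (max (f (s n) \<omega>) (f i \<omega>)) \<partial>M) \<le> c"
        using e_le_c[OF d(1)[OF s_in i]] order_trans by blast
    qed
    moreover have "(\<integral>\<omega>. arctan (max (Z \<omega>) (f i \<omega>)) - arctan (Z \<omega>) \<partial>M) =
        (\<integral>\<omega>. arctan (max (Z \<omega>) (f i \<omega>)) \<partial>M) - c"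
      unfolding e_Z[symmetric] by (intro Bochner_Integration.integral_diff int) auto
    moreover have "0 \<le> (\<integral>\<omega>. arctan (max (Z \<omega>) (f i \<omega>)) - arctan (Z \<omega>) \<partial>M)"
      by (intro integral_nonneg_AE) (auto simp: arctan_le_iff)
    ultimately have "(\<integral>\<omega>. arctan (max (Z \<omega>) (f i \<omega>)) - arctan (Z \<omega>) \<partial>M) = 0"
      by linarith
    moreover have "integrable M (\<lambda>\<omega>. arctan (max (Z \<omega>) (f i \<omega>)) - arctan (Z \<omega>))"
      by (intro Bochner_Integration.integrable_diff int) auto
    ultimately have "AE \<omega> in M. arctan (max (Z \<omega>) (f i \<omega>)) - arctan (Z \<omega>) = 0"
      by (subst (asm) integral_nonneg_eq_0_iff_AE) (auto simp: arctan_le_iff)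
    then show ?thesis
      by (auto simp: arctan_eq_iff max_def split: if_splits elim!: eventually_mono)
  qed
  then have "AE \<omega> in M. ereal (Y \<omega>) \<le> ereal (Z \<omega>)"
    by (intro is_ess_sup_least[OF Y]) auto
  moreover have "AE \<omega> in M. \<forall>n. f (s n) \<omega> \<le> Y \<omega>"
    unfolding AE_all_countable using f_le_Y[OF s_in] by auto
  ultimately have "AE \<omega> in M. (\<lambda>n. f (s n) \<omega>) \<longlonglongrightarrow> Y \<omega>"
    using Z_lim
  proof eventually_elim
    case (elim \<omega>)
    have "Z \<omega> \<le> Y \<omega>"
      using elim by (intro LIMSEQ_le_const2[OF elim(3)]) auto
    with elim show ?case by simp
  qed
  with that s_in s_mono show thesis by blast
qed

section \<open>Completeness and events of stopping times\<close>

text \<open>Both differences of \<open>A\<close> and \<open>B\<close> lie in one null set, so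
  completeness of \<open>M\<close> makes them null sets and thus members of \<open>G\<close>.
  Nothing is assumed about measurability of \<open>A\<close>.\<close>

lemma (in complete_measure) sets_AE_cong:
  assumes "null_sets M \<subseteq> sets G" "B \<in> sets G" "A \<subseteq> space M" "B \<subseteq> space M"
    and AE: "AE \<omega> in M. \<omega> \<in> A \<longleftrightarrow> \<omega> \<in> B"
  shows "A \<in> sets G"
proof -
  have N: "{\<omega> \<in> space M. \<not> (\<omega> \<in> A \<longleftrightarrow> \<omega> \<in> B)} \<in> null_sets M"
    using AE unfolding AE_iff_null_sets .
  have "A - B \<in> null_sets M" "B - A \<in> null_sets M"
    by (rule complete2[OF _ N], use assms in auto)+
  then have "(B - (B - A)) \<union> (A - B) \<in> sets G"
    using assms by auto
  also have "(B - (B - A)) \<union> (A - B) = A" by auto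
  finally show ?thesis .
qed

lemma (in complete_measure) borel_measurable_AE_cong:
  assumes "null_sets M \<subseteq> sets G" "space G = space M"
    and g: "g \<in> borel_measurable G" and AE: "AE \<omega> in M. f \<omega> = g \<omega>"
  shows "f \<in> borel_measurable G"
proof (rule measurableI)
  fix S :: "'b set" assume "S \<in> sets borel"
  with g have "g -` S \<inter> space M \<in> sets G"
    using measurable_sets[OF g] assms(2) by auto
  then show "f -` S \<inter> space G \<in> sets G"
    by (rule sets_AE_cong[OF assms(1)]) (use AE assms(2) in \<open>auto elim!: eventually_mono\<close>)
qed simp

text \<open>At time \<open>t\<close> only the truncations of both times at \<open>t\<close> are
  observable, so these are compared. The extra condition \<open>\<sigma> \<omega> \<le> t\<close>
  excludes the case of \<open>\<tau> \<omega> = t < \<sigma> \<omega>\<close>, where the truncations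
  coincide but the times do not.\<close>

lemma (in filtration) stopping_time_eq:
  fixes \<tau> \<sigma> :: "'a \<Rightarrow> 't"
  assumes \<tau>: "stopping_time F \<tau>" and \<sigma>: "stopping_time F \<sigma>"
  shows "{\<omega> \<in> \<Omega>. \<tau> \<omega> = \<sigma> \<omega>} \<in> sets (pre_sigma \<tau>)"
proof (rule sets_pre_sigmaI[OF \<tau>])
  fix t
  have min_meas: "(\<lambda>\<omega>. min (\<upsilon> \<omega>) t) \<in> borel_measurable (F t)" if "stopping_time F \<upsilon>" for \<upsilon>
  proof (rule borel_measurableI_le)
    fix s
    show "{\<omega> \<in> space (F t). min (\<upsilon> \<omega>) t \<le> s} \<in> sets (F t)"
      using stopping_time_le_const[OF that, of s t]
      by (cases "t \<le> s") (auto simp: pred_def min_le_iff_disj)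
  qed
  note [measurable] = min_meas[OF \<tau>] min_meas[OF \<sigma>] stopping_timeD[OF \<tau>] stopping_timeD[OF \<sigma>]
  have "{\<omega> \<in> space (F t). min (\<tau> \<omega>) t = min (\<sigma> \<omega>) t \<and> \<tau> \<omega> \<le> t \<and> \<sigma> \<omega> \<le> t} \<in> sets (F t)"
    by measurable
  also have "{\<omega> \<in> space (F t). min (\<tau> \<omega>) t = min (\<sigma> \<omega>) t \<and> \<tau> \<omega> \<le> t \<and> \<sigma> \<omega> \<le> t} =
      {\<omega> \<in> {\<omega> \<in> \<Omega>. \<tau> \<omega> = \<sigma> \<omega>}. \<tau> \<omega> \<le> t}"
    by (auto simp: space_F)
  finally show "{\<omega> \<in> {\<omega> \<in> \<Omega>. \<tau> \<omega> = \<sigma> \<omega>}. \<tau> \<omega> \<le> t} \<in> sets (F t)" .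
qed

context bermudan
begin

lemma null_sets_F: "0 \<le> t \<Longrightarrow> null_sets M \<subseteq> sets (F t)"
  using F_complete sets_F_mono[of 0 t] by blast

lemma null_sets_pre_sigma:
  assumes \<tau>: "stopping_time F \<tau>" "\<And>\<omega>. \<omega> \<in> space M \<Longrightarrow> 0 \<le> \<tau> \<omega>"
  shows "null_sets M \<subseteq> sets (pre_sigma \<tau>)"
proof
  fix N assume N: "N \<in> null_sets M"
  show "N \<in> sets (pre_sigma \<tau>)"
  proof (rule sets_pre_sigmaI[OF \<tau>(1)])
    fix t :: real
    show "{\<omega> \<in> N. \<tau> \<omega> \<le> t} \<in> sets (F t)"
    proof (cases "0 \<le> t")
      case True
      then show ?thesis
        using null_sets_F complete2[OF _ N, of "{\<omega> \<in> N. \<tau> \<omega> \<le> t}"] by auto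
    next
      \<comment> \<open>Before time 0 the filtration need not contain the null sets, but a
        nonnegative time leaves nothing to measure there.\<close>
      case False
      have "N \<subseteq> space M"
        using N by (auto dest: sets.sets_into_space)
      then have "{\<omega> \<in> N. \<tau> \<omega> \<le> t} = {}"
        using False assms(2) by force
      then show ?thesis by (simp only: sets.empty_sets)
    qed
  qed
qed

lemma sets_pre_sigma_subset_F:
  assumes \<tau>: "stopping_time F \<tau>" "\<And>\<omega>. \<omega> \<in> space M \<Longrightarrow> \<tau> \<omega> \<le> T"
  shows "sets (pre_sigma \<tau>) \<subseteq> sets (F T)"
proof
  fix A assume A: "A \<in> sets (pre_sigma \<tau>)"
  have "{\<omega> \<in> A. \<tau> \<omega> \<le> T} = A"
    using sets.sets_into_space[OF A] \<tau>(2) by (auto simp: space_pre_sigma)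
  then show "A \<in> sets (F T)"
    using sets_pre_sigmaD[OF \<tau>(1) A, of T] by simp
qed

section \<open>The class of stopping times \<open>Theta\<close>\<close>

text \<open>The partition in the definition can be recovered from the values of
  \<open>\<tau>\<close>, by sorting points according to the first index \<open>k\<close> with
  \<open>\<tau> \<omega> = \<theta> k \<omega>\<close>. What remains is a pointwise condition,
  easily checked for maxima and pastings.\<close>

lemma Theta_iff:
  "\<tau> \<in> Theta \<longleftrightarrow> stopping_time F \<tau> \<and> (\<forall>\<omega>\<in>space M. \<tau> \<omega> \<in> {0..T}) \<and>
    (AE \<omega> in M. (\<exists>k. \<tau> \<omega> = \<theta> k \<omega>) \<or> \<tau> \<omega> = T)" (is "_ \<longleftrightarrow> ?st \<and> ?range \<and> ?vals")
proof -
  have sum_eq: "(\<Sum>k. \<theta> k \<omega> * indicator (A k) \<omega>) = \<theta> j \<omega>"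
    if "disjoint_family A" "\<omega> \<in> A j" for A :: "nat \<Rightarrow> 'a set" and j \<omega>
  proof -
    have "indicator (A k) \<omega> = (0::real)" if "k \<noteq> j" for k
      using disjoint_family_onD[OF \<open>disjoint_family A\<close>, of k j] that \<open>\<omega> \<in> A j\<close>
      by (auto simp: indicator_def)
    then show ?thesis
      using suminf_finite[of "{j}" "\<lambda>k. \<theta> k \<omega> * indicator (A k) \<omega>"] \<open>\<omega> \<in> A j\<close> by simp
  qed
  have "?vals" if \<tau>: "\<tau> \<in> Theta"
  proof -
    from \<tau> obtain A B where AB: "disjoint_family A" "\<forall>k. A k \<inter> B = {}" "(\<Union>k. A k) \<union> B = space M"
      and eq: "AE \<omega> in M. \<tau> \<omega> = (\<Sum>k. \<theta> k \<omega> * indicator (A k) \<omega>) + T * indicator B \<omega>"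
      unfolding Theta_def mem_Collect_eq by (elim conjE exE) (rule that)
    from eq AE_space show ?thesis
    proof eventually_elim
      case (elim \<omega>)
      then consider j where "\<omega> \<in> A j" | "\<omega> \<in> B" using AB(3) by auto
      then show ?case
      proof cases
        case 1
        then show ?thesis using elim AB(2) sum_eq[OF AB(1) 1] by (auto simp: indicator_def)
      next
        case 2
        then have "\<omega> \<notin> A k" for k using AB(2) by blast
        then show ?thesis using elim 2 by simp
      qed
    qed
  qed
  moreover have "\<tau> \<in> Theta" if st: "?st" and range: "?range" and vals: "?vals"
  proof -
    define E where "E k j = {\<omega> \<in> space M. \<theta> k \<omega> = \<theta> j \<omega>}" for k j
    define D where "D k = {\<omega> \<in> space M. \<theta> k \<omega> = \<tau> \<omega>}" for k
    \<comment> \<open>On \<open>D k\<close>, removing \<open>E k j\<close> is the same as removing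
      \<open>D j\<close>. The sets \<open>E k j\<close> are used because they belong to
      \<open>pre_sigma (\<theta> k)\<close>, whereas \<open>stopping_time_eq\<close> places
      \<open>D j\<close> in \<open>pre_sigma (\<theta> j)\<close>.\<close>
    define A where "A k = D k - (\<Union>j<k. E k j)" for k
    define B where "B = space M - (\<Union>k. A k)"
    have A: "A k \<in> sets (pre_sigma (\<theta> k))" for k
      unfolding A_def D_def E_def
      by (intro sets.Diff sets.finite_UN stopping_time_eq stopping_theta st ballI finite_lessThan)
    have "A k \<in> sets (F T)" for k
      using A sets_pre_sigma_subset_F[OF stopping_theta[of k]] theta_range by fastforce
    then have B: "B \<in> sets (F T)"
      unfolding B_def using space_F[of T] sets.top[of "F T"] by auto
    have disj: "disjoint_family A"
    proof -
      have "A j \<inter> A k = {}" if "j < k" for j k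
        using that unfolding A_def D_def E_def by fastforce
      then show ?thesis
        unfolding disjoint_family_on_def by (metis inf_commute linorder_neqE_nat)
    qed
    have UN_A: "(\<Union>k. A k) = (\<Union>k. D k)"
    proof -
      have "\<exists>j. \<omega> \<in> A j" if "\<omega> \<in> D k" for \<omega> k
        using that
      proof (induction k rule: less_induct)
        case (less k)
        show ?case
        proof (cases "\<exists>j<k. \<omega> \<in> E k j")
          case True
          then obtain j where "j < k" "\<omega> \<in> E k j" by blast
          with less show ?thesis by (auto simp: D_def E_def)
        next
          case False
          with less.prems show ?thesis by (auto simp: A_def intro!: exI[of _ k])
        qed
      qed
      then show ?thesis unfolding A_def by blast
    qed
    have "AE \<omega> in M. \<tau> \<omega> = (\<Sum>k. \<theta> k \<omega> * indicator (A k) \<omega>) + T * indicator B \<omega>"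
      using vals AE_space
    proof eventually_elim
      case (elim \<omega>)
      then consider j where "\<omega> \<in> A j" | "\<omega> \<in> B" unfolding B_def by auto
      then show ?case
      proof cases
        case 1
        then show ?thesis
          using sum_eq[OF disj 1] by (auto simp: B_def A_def D_def indicator_def)
      next
        case 2
        then have "\<omega> \<notin> A k" "\<omega> \<notin> D k" for k using UN_A unfolding B_def by auto
        then show ?thesis using elim 2 by (fastforce simp: D_def)
      qed
    qed
    moreover have "A k \<inter> B = {}" for k unfolding B_def by auto
    moreover have "(\<Union>k. A k) \<union> B = space M"
      unfolding B_def UN_A by (auto simp: D_def)
    ultimately show ?thesis
      unfolding Theta_def mem_Collect_eq using st range A B disj
      by (intro conjI exI[of _ A] exI[of _ B]) auto
  qed
  moreover have "?st \<and> ?range" if "\<tau> \<in> Theta"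
    using that by (simp add: Theta_def)
  ultimately show ?thesis by blast
qed

lemma ThetaD:
  assumes "\<tau> \<in> Theta"
  shows "stopping_time F \<tau>" "\<And>\<omega>. \<omega> \<in> space M \<Longrightarrow> 0 \<le> \<tau> \<omega>" "\<And>\<omega>. \<omega> \<in> space M \<Longrightarrow> \<tau> \<omega> \<le> T"
    "AE \<omega> in M. (\<exists>k. \<tau> \<omega> = \<theta> k \<omega>) \<or> \<tau> \<omega> = T"
  using assms unfolding Theta_iff by auto

lemma theta_in_Theta: "\<theta> k \<in> Theta"
  unfolding Theta_iff using stopping_theta theta_range by auto

lemma T_in_Theta: "(\<lambda>_. T) \<in> Theta"
  unfolding Theta_iff using T_pos by (auto intro: stopping_time_const)

lemma max_in_Theta:
  assumes "\<tau> \<in> Theta" "\<sigma> \<in> Theta"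
  shows "(\<lambda>\<omega>. max (\<tau> \<omega>) (\<sigma> \<omega>)) \<in> Theta"
  unfolding Theta_iff
proof (intro conjI)
  show "AE \<omega> in M. (\<exists>k. max (\<tau> \<omega>) (\<sigma> \<omega>) = \<theta> k \<omega>) \<or> max (\<tau> \<omega>) (\<sigma> \<omega>) = T"
    using ThetaD(4)[OF assms(1)] ThetaD(4)[OF assms(2)]
    by eventually_elim (auto simp: max_def)
qed (use ThetaD[OF assms(1)] ThetaD[OF assms(2)] in
    \<open>auto intro: stopping_time_max simp: le_max_iff_disj\<close>)

text \<open>For \<open>t \<ge> 0\<close>, the set \<open>A\<close> is known at time \<open>t\<close>
  only on the event of \<open>S \<omega> \<le> t\<close>. That suffices: off this event both
  \<open>\<tau>\<close> and \<open>\<sigma>\<close> exceed \<open>t\<close> a.s. As the ordering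
  holds only a.s., the decomposition \<open>?B\<close> is correct up to a null set, and
  \<open>F t\<close> contains the null sets.\<close>

lemma paste_in_Theta_from:
  assumes S: "S \<in> Theta" and A: "A \<in> sets (pre_sigma S)"
    and \<tau>: "\<tau> \<in> Theta_from S" and \<sigma>: "\<sigma> \<in> Theta_from S"
  shows "(\<lambda>\<omega>. if \<omega> \<in> A then \<tau> \<omega> else \<sigma> \<omega>) \<in> Theta_from S" (is "?\<upsilon> \<in> _")
proof -
  have Th: "\<tau> \<in> Theta" "\<sigma> \<in> Theta" and le: "AE \<omega> in M. S \<omega> \<le> \<tau> \<omega>" "AE \<omega> in M. S \<omega> \<le> \<sigma> \<omega>"
    using \<tau> \<sigma> by (auto simp: Theta_from_def)
  have "stopping_time F ?\<upsilon>"
  proof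
    fix t :: real
    show "Measurable.pred (F t) (\<lambda>\<omega>. ?\<upsilon> \<omega> \<le> t)"
    proof (cases "0 \<le> t")
      case True
      have L: "{\<omega> \<in> space M. \<upsilon> \<omega> \<le> t} \<in> sets (F t)" if "\<upsilon> \<in> Theta" for \<upsilon>
        using stopping_timeD[OF ThetaD(1)[OF that], of t] by (simp add: pred_def space_F)
      let ?A = "{\<omega> \<in> A. S \<omega> \<le> t}"
      let ?B = "(?A \<inter> {\<omega> \<in> space M. \<tau> \<omega> \<le> t}) \<union>
        (({\<omega> \<in> space M. S \<omega> \<le> t} - ?A) \<inter> {\<omega> \<in> space M. \<sigma> \<omega> \<le> t})"
      have "?B \<in> sets (F t)"
        by (intro sets.Un sets.Int sets.Diff L Th S sets_pre_sigmaD[OF ThetaD(1)[OF S] A])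
      then have "{\<omega> \<in> space M. ?\<upsilon> \<omega> \<le> t} \<in> sets (F t)"
      proof (rule sets_AE_cong[OF null_sets_F[OF True]])
        show "AE \<omega> in M. \<omega> \<in> {\<omega> \<in> space M. ?\<upsilon> \<omega> \<le> t} \<longleftrightarrow> \<omega> \<in> ?B"
          using le AE_space by eventually_elim auto
      qed blast+
      then show ?thesis by (simp add: pred_def space_F)
    next
      case False
      then have "{\<omega> \<in> space M. ?\<upsilon> \<omega> \<le> t} = {}"
        using ThetaD(2)[OF Th(1)] ThetaD(2)[OF Th(2)] by force
      then show ?thesis by (simp only: pred_def space_F sets.empty_sets)
    qed
  qed
  moreover have "AE \<omega> in M. (\<exists>k. ?\<upsilon> \<omega> = \<theta> k \<omega>) \<or> ?\<upsilon> \<omega> = T"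
    using ThetaD(4)[OF Th(1)] ThetaD(4)[OF Th(2)] by eventually_elim auto
  moreover have "AE \<omega> in M. S \<omega> \<le> ?\<upsilon> \<omega>"
    using le by eventually_elim auto
  ultimately show ?thesis
    unfolding Theta_from_def Theta_iff using ThetaD[OF Th(1)] ThetaD[OF Th(2)] by auto
qed

lemma Theta_from_refl: "S \<in> Theta \<Longrightarrow> S \<in> Theta_from S"
  by (simp add: Theta_from_def)

lemma Theta_from_theta_Suc: "\<theta> (Suc k) \<in> Theta_from (\<theta> k)"
  using theta_in_Theta theta_mono by (simp add: Theta_from_def)

lemma Theta_from_trans: "\<tau> \<in> Theta_from S \<Longrightarrow> \<upsilon> \<in> Theta_from \<tau> \<Longrightarrow> \<upsilon> \<in> Theta_from S"
proof -
  assume "\<tau> \<in> Theta_from S" "\<upsilon> \<in> Theta_from \<tau>"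
  then have "AE \<omega> in M. S \<omega> \<le> \<tau> \<omega>" "AE \<omega> in M. \<tau> \<omega> \<le> \<upsilon> \<omega>" "\<upsilon> \<in> Theta"
    by (simp_all add: Theta_from_def)
  then show ?thesis
    by (auto simp: Theta_from_def)
qed

lemma AE_theta_le: "j \<le> k \<Longrightarrow> AE \<omega> in M. \<theta> j \<omega> \<le> \<theta> k \<omega>"
proof (induction k rule: dec_induct)
  case (step k)
  from step.IH theta_mono[of k] show ?case by eventually_elim simp
qed simp

text \<open>Almost surely the value of \<open>\<tau>\<close> is some
  \<open>\<theta> j \<omega>\<close> or \<open>T\<close>. For \<open>j \<le> k\<close> it is
  squeezed to \<open>\<theta> k \<omega>\<close>; for \<open>j > k\<close>, and for
  \<open>T\<close>, it is at least the next date.\<close>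

lemma Theta_from_theta_cases:
  assumes \<tau>: "\<tau> \<in> Theta_from (\<theta> k)"
  shows "AE \<omega> in M. \<tau> \<omega> = \<theta> k \<omega> \<or> \<theta> (Suc k) \<omega> \<le> \<tau> \<omega>"
proof -
  have *: "AE \<omega> in M. \<forall>i j. i \<le> j \<longrightarrow> \<theta> i \<omega> \<le> \<theta> j \<omega>"
    unfolding AE_all_countable using AE_theta_le by auto
  have "AE \<omega> in M. \<theta> k \<omega> \<le> \<tau> \<omega>" "\<tau> \<in> Theta"
    using \<tau> by (auto simp: Theta_from_def)
  from ThetaD(4)[OF this(2)] this(1) * AE_space show ?thesis
  proof eventually_elim
    case (elim \<omega>)
    from elim(1) show ?case
    proof
      assume "\<exists>j. \<tau> \<omega> = \<theta> j \<omega>"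
      then obtain j where j: "\<tau> \<omega> = \<theta> j \<omega>" ..
      show ?thesis
      proof (cases "j \<le> k")
        case True
        then show ?thesis using elim j by (intro disjI1 antisym) auto
      next
        case False
        then show ?thesis using elim j by (intro disjI2) auto
      qed
    qed (use theta_range elim in auto)
  qed
qed

section \<open>Measurability and integrability at stopping times\<close>

lemma pre_sigma_subset_M: "\<tau> \<in> Theta \<Longrightarrow> sets (pre_sigma \<tau>) \<subseteq> sets M"
  using sets_pre_sigma_subset_F[OF ThetaD(1,3)] F_subset[of T] T_pos by force

lemma measurable_pre_sigma_M:
  "\<tau> \<in> Theta \<Longrightarrow> f \<in> borel_measurable (pre_sigma \<tau>) \<Longrightarrow> f \<in> borel_measurable M"
  using pre_sigma_subset_M[of \<tau>] by (auto simp: measurable_def space_pre_sigma)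

lemma Lp_pre_sigma_iff:
  "\<tau> \<in> Theta \<Longrightarrow> f \<in> Lp (pre_sigma \<tau>) \<longleftrightarrow> f \<in> borel_measurable (pre_sigma \<tau>) \<and> f \<in> Lp M"
  unfolding Lp_def using measurable_pre_sigma_M by auto

lemma Lp_AE_cong:
  assumes f: "f \<in> Lp M" and eq: "AE \<omega> in M. g \<omega> = f \<omega>"
  shows "g \<in> Lp M"
proof -
  have [measurable]: "f \<in> borel_measurable M"
    using f by (simp add: Lp_def)
  \<comment> \<open>Measurability of \<open>g\<close> is not assumed; it follows from completeness
    of \<open>M\<close>.\<close>
  have [measurable]: "g \<in> borel_measurable M"
    by (rule borel_measurable_AE_cong[OF _ _ _ eq]) auto
  have "esssup M (\<lambda>\<omega>. ereal \<bar>g \<omega>\<bar>) = esssup M (\<lambda>\<omega>. ereal \<bar>f \<omega>\<bar>)"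
    by (rule esssup_AE_cong) (use eq in auto)
  moreover have "integrable M (\<lambda>\<omega>. \<bar>g \<omega>\<bar> powr enn2real p) \<longleftrightarrow>
      integrable M (\<lambda>\<omega>. \<bar>f \<omega>\<bar> powr enn2real p)"
    by (rule integrable_cong_AE) (use eq in auto)
  ultimately show ?thesis
    using f by (auto simp: Lp_def split: if_splits)
qed

lemma xi_Lp:
  assumes "admissible \<xi>" "p_integrable \<xi>" "\<tau> \<in> Theta"
  shows "\<xi> \<tau> \<in> Lp (pre_sigma \<tau>)"
  using assms by (simp add: Lp_pre_sigma_iff admissible_def p_integrable_def)

section \<open>Directedness and approximation of the value family\<close>

lemma zero_one_lawD:
  assumes "zero_one_law \<rho>" "admissible \<xi>" "p_integrable \<xi>" "S \<in> Theta"
    "A \<in> sets (pre_sigma S)" "\<tau> \<in> Theta_from S" "\<tau>' \<in> Theta_from S"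
    "AE \<omega> in M. \<omega> \<in> A \<longrightarrow> \<tau> \<omega> = \<tau>' \<omega>"
  shows "AE \<omega> in M. \<omega> \<in> A \<longrightarrow> \<rho> S \<tau> (\<xi> \<tau>) \<omega> = \<rho> S \<tau>' (\<xi> \<tau>') \<omega>"
proof -
  have "AE \<omega> in M. indicator A \<omega> * \<rho> S \<tau> (\<xi> \<tau>) \<omega> = indicator A \<omega> * \<rho> S \<tau>' (\<xi> \<tau>') \<omega>"
    using assms unfolding zero_one_law_def by blast
  then show ?thesis
    by eventually_elim (auto simp: indicator_def)
qed

lemma rho_directed:
  assumes op: "operator_family \<rho>" and adm: "admissible \<xi>" and p_int: "p_integrable \<xi>"
    and zol: "zero_one_law \<rho>"
    and S: "S \<in> Theta" and \<tau>: "\<tau> \<in> Theta_from S" and \<sigma>: "\<sigma> \<in> Theta_from S"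
  shows "\<exists>\<upsilon>\<in>Theta_from S.
    AE \<omega> in M. max (\<rho> S \<tau> (\<xi> \<tau>) \<omega>) (\<rho> S \<sigma> (\<xi> \<sigma>) \<omega>) \<le> \<rho> S \<upsilon> (\<xi> \<upsilon>) \<omega>"
proof -
  have Th: "\<tau> \<in> Theta" "\<sigma> \<in> Theta"
    using \<tau> \<sigma> by (auto simp: Theta_from_def)
  have [measurable]: "\<rho> S \<tau> (\<xi> \<tau>) \<in> borel_measurable (pre_sigma S)"
    "\<rho> S \<sigma> (\<xi> \<sigma>) \<in> borel_measurable (pre_sigma S)"
    using op xi_Lp[OF adm p_int] S Th unfolding operator_family_def Lp_def by blast+
  \<comment> \<open>The event on which \<open>\<tau>\<close> does at least as well as
    \<open>\<sigma>\<close>. It is known at \<open>S\<close> because the operators have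
    \<open>pre_sigma S\<close>-measurable values, so the choice between the two times may be made
    there.\<close>
  define A where "A = {\<omega> \<in> space (pre_sigma S). \<rho> S \<sigma> (\<xi> \<sigma>) \<omega> \<le> \<rho> S \<tau> (\<xi> \<tau>) \<omega>}"
  have A: "A \<in> sets (pre_sigma S)"
    unfolding A_def by measurable
  define \<upsilon> where "\<upsilon> = (\<lambda>\<omega>. if \<omega> \<in> A then \<tau> \<omega> else \<sigma> \<omega>)"
  have \<upsilon>: "\<upsilon> \<in> Theta_from S"
    unfolding \<upsilon>_def by (rule paste_in_Theta_from[OF S A \<tau> \<sigma>])
  have "AE \<omega> in M. \<omega> \<in> A \<longrightarrow> \<rho> S \<upsilon> (\<xi> \<upsilon>) \<omega> = \<rho> S \<tau> (\<xi> \<tau>) \<omega>"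
    by (rule zero_one_lawD[OF zol adm p_int S A \<upsilon> \<tau>]) (simp add: \<upsilon>_def)
  moreover have "AE \<omega> in M. \<omega> \<in> space (pre_sigma S) - A \<longrightarrow>
      \<rho> S \<upsilon> (\<xi> \<upsilon>) \<omega> = \<rho> S \<sigma> (\<xi> \<sigma>) \<omega>"
    by (rule zero_one_lawD[OF zol adm p_int S _ \<upsilon> \<sigma>]) (use A in \<open>auto simp: \<upsilon>_def\<close>)
  ultimately have "AE \<omega> in M. max (\<rho> S \<tau> (\<xi> \<tau>) \<omega>) (\<rho> S \<sigma> (\<xi> \<sigma>) \<omega>) \<le> \<rho> S \<upsilon> (\<xi> \<upsilon>) \<omega>"
    using AE_space by eventually_elim (auto simp: A_def space_pre_sigma)
  with \<upsilon> show ?thesis by blast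
qed

lemma value_sequence:
  assumes op: "operator_family \<rho>" and adm: "admissible \<xi>" and p_int: "p_integrable \<xi>"
    and zol: "zero_one_law \<rho>" and val: "is_value_family \<rho> \<xi> V" and S: "S \<in> Theta"
  shows "\<exists>s. (\<forall>n::nat. s n \<in> Theta_from S) \<and>
    (\<forall>n. AE \<omega> in M. \<rho> S (s n) (\<xi> (s n)) \<omega> \<le> \<rho> S (s (Suc n)) (\<xi> (s (Suc n))) \<omega>) \<and>
    (AE \<omega> in M. (\<lambda>n. \<rho> S (s n) (\<xi> (s n)) \<omega>) \<longlonglongrightarrow> V S \<omega>)"
proof (rule directed_ess_sup_sequence)
  show "Theta_from S \<noteq> {}"
    using Theta_from_refl[OF S] by auto
  show "\<rho> S \<tau> (\<xi> \<tau>) \<in> borel_measurable M" if "\<tau> \<in> Theta_from S" for \<tau>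
    using op xi_Lp[OF adm p_int] S that Lp_pre_sigma_iff[OF S] measurable_pre_sigma_M[OF S]
    unfolding operator_family_def Theta_from_def by blast
  show "\<exists>\<upsilon>\<in>Theta_from S.
      AE \<omega> in M. max (\<rho> S \<tau> (\<xi> \<tau>) \<omega>) (\<rho> S \<sigma> (\<xi> \<sigma>) \<omega>) \<le> \<rho> S \<upsilon> (\<xi> \<upsilon>) \<omega>"
    if "\<tau> \<in> Theta_from S" "\<sigma> \<in> Theta_from S" for \<tau> \<sigma>
    by (rule rho_directed[OF op adm p_int zol S that])
  show "is_ess_sup M {\<lambda>\<omega>. ereal (\<rho> S \<tau> (\<xi> \<tau>) \<omega>) | \<tau>. \<tau> \<in> Theta_from S} (\<lambda>\<omega>. ereal (V S \<omega>))"
    using val S by (simp add: is_value_family_def)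
qed (intro exI conjI allI)

text \<open>An essential supremum is by definition only \<open>M\<close>-measurable, but
  \<open>\<rho>\<close> can be applied to \<open>V S\<close> only if it is measurable at
  \<open>S\<close>. The approximating sequence supplies this: its terms are measurable at
  \<open>S\<close>, and \<open>pre_sigma S\<close> contains the null sets.\<close>

lemma value_Lp:
  assumes op: "operator_family \<rho>" and adm: "admissible \<xi>" and p_int: "p_integrable \<xi>"
    and zol: "zero_one_law \<rho>" and val: "is_value_family \<rho> \<xi> V" and S: "S \<in> Theta"
    and V: "V S \<in> Lp M"
  shows "V S \<in> Lp (pre_sigma S)"
proof -
  obtain s where s: "\<forall>n::nat. s n \<in> Theta_from S"
    and lim: "AE \<omega> in M. (\<lambda>n. \<rho> S (s n) (\<xi> (s n)) \<omega>) \<longlonglongrightarrow> V S \<omega>"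
    using value_sequence[OF op adm p_int zol val S] by (elim exE conjE)
  have [measurable]: "\<rho> S (s n) (\<xi> (s n)) \<in> borel_measurable (pre_sigma S)" for n
    using op xi_Lp[OF adm p_int] S s[rule_format, of n]
    unfolding operator_family_def Lp_def Theta_from_def by blast
  have "V S \<in> borel_measurable (pre_sigma S)"
  proof (rule borel_measurable_AE_cong)
    show "null_sets M \<subseteq> sets (pre_sigma S)"
      by (rule null_sets_pre_sigma[OF ThetaD(1,2)[OF S]])
    show "(\<lambda>\<omega>. lim (\<lambda>n. \<rho> S (s n) (\<xi> (s n)) \<omega>)) \<in> borel_measurable (pre_sigma S)"
      by measurable
    show "AE \<omega> in M. V S \<omega> = lim (\<lambda>n. \<rho> S (s n) (\<xi> (s n)) \<omega>)"
      using lim by eventually_elim (simp add: limI)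
  qed (simp add: space_pre_sigma)
  with V S show ?thesis
    by (simp add: Lp_pre_sigma_iff)
qed

section \<open>The two inequalities of dynamic programming\<close>

lemma rho_le_value:
  assumes "is_value_family \<rho> \<xi> V" "S \<in> Theta" "\<tau> \<in> Theta_from S"
  shows "AE \<omega> in M. \<rho> S \<tau> (\<xi> \<tau>) \<omega> \<le> V S \<omega>"
proof -
  have "AE \<omega> in M. ereal (\<rho> S \<tau> (\<xi> \<tau>) \<omega>) \<le> ereal (V S \<omega>)"
  proof (rule is_ess_sup_upper)
    show "is_ess_sup M {\<lambda>\<omega>. ereal (\<rho> S \<tau> (\<xi> \<tau>) \<omega>) | \<tau>. \<tau> \<in> Theta_from S} (\<lambda>\<omega>. ereal (V S \<omega>))"
      using assms by (simp add: is_value_family_def)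
  qed (use assms in blast)
  then show ?thesis by simp
qed

lemma value_le:
  assumes val: "is_value_family \<rho> \<xi> V" and S: "S \<in> Theta"
    and Z [measurable]: "Z \<in> borel_measurable M"
    and le: "\<And>\<tau>. \<tau> \<in> Theta_from S \<Longrightarrow> AE \<omega> in M. \<rho> S \<tau> (\<xi> \<tau>) \<omega> \<le> Z \<omega>"
  shows "AE \<omega> in M. V S \<omega> \<le> Z \<omega>"
proof -
  have "is_ess_sup M {\<lambda>\<omega>. ereal (\<rho> S \<tau> (\<xi> \<tau>) \<omega>) | \<tau>. \<tau> \<in> Theta_from S} (\<lambda>\<omega>. ereal (V S \<omega>))"
    using val S by (simp add: is_value_family_def)
  then have "AE \<omega> in M. ereal (V S \<omega>) \<le> ereal (Z \<omega>)"
    by (rule is_ess_sup_least) (use le in auto)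
  then show ?thesis by simp
qed

text \<open>The supermartingale property of \<open>V\<close>. Consistency turns
  \<open>\<rho> S \<nu>\<close> of each approximating term for \<open>V \<nu>\<close> into a member
  of the family that defines \<open>V S\<close>; the Fatou property carries the bound to the
  limit.\<close>

lemma rho_value_le_value:
  assumes op: "operator_family \<rho>" and adm: "admissible \<xi>" and p_int: "p_integrable \<xi>"
    and zol: "zero_one_law \<rho>" and val: "is_value_family \<rho> \<xi> V"
    and con: "consistent \<rho>" and fatou: "monotone_Fatou \<rho>"
    and S: "S \<in> Theta" and \<nu>: "\<nu> \<in> Theta_from S" and V: "V \<nu> \<in> Lp M"
  shows "AE \<omega> in M. \<rho> S \<nu> (V \<nu>) \<omega> \<le> V S \<omega>"
proof -
  have \<nu>_Th: "\<nu> \<in> Theta"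
    using \<nu> by (simp add: Theta_from_def)
  from value_sequence[OF op adm p_int zol val \<nu>_Th]
  obtain s where s_all: "\<forall>n::nat. s n \<in> Theta_from \<nu>"
    and mono: "\<forall>n. AE \<omega> in M. \<rho> \<nu> (s n) (\<xi> (s n)) \<omega> \<le> \<rho> \<nu> (s (Suc n)) (\<xi> (s (Suc n))) \<omega>"
    and lim: "AE \<omega> in M. (\<lambda>n. \<rho> \<nu> (s n) (\<xi> (s n)) \<omega>) \<longlonglongrightarrow> V \<nu> \<omega>"
    by (elim exE conjE)
  have s: "s n \<in> Theta_from \<nu>" for n
    using s_all by blast
  have s_Th: "s n \<in> Theta" for n
    using s by (simp add: Theta_from_def)
  define \<eta> where "\<eta> n = \<rho> \<nu> (s n) (\<xi> (s n))" for n
  have \<eta>: "\<eta> n \<in> Lp (pre_sigma \<nu>)" for n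
    using op xi_Lp[OF adm p_int s_Th] s_Th \<nu>_Th unfolding \<eta>_def operator_family_def by blast
  have "AE \<omega> in M. \<forall>n. \<eta> n \<omega> \<le> \<eta> (Suc n) \<omega>"
    unfolding AE_all_countable \<eta>_def using mono by blast
  \<comment> \<open>A real \<open>SUP\<close> is meaningful only for bounded sequences. Convergence
    to \<open>V \<nu> \<omega>\<close> gives boundedness a.s., so the supremum is a.s. the limit and
    inherits its integrability.\<close>
  then have "AE \<omega> in M. (SUP n. \<eta> n \<omega>) = V \<nu> \<omega>"
    using lim
  proof eventually_elim
    case (elim \<omega>)
    then have inc: "incseq (\<lambda>n. \<eta> n \<omega>)" and l: "(\<lambda>n. \<eta> n \<omega>) \<longlonglongrightarrow> V \<nu> \<omega>"
      by (auto simp: incseq_Suc_iff \<eta>_def)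
    have "bdd_above (range (\<lambda>n. \<eta> n \<omega>))"
      by (rule bdd_aboveI2) (rule incseq_le[OF inc l])
    then show ?case
      using LIMSEQ_unique[OF LIMSEQ_incseq_SUP[OF _ inc] l] by simp
  qed
  then have SUP_Lp: "(\<lambda>\<omega>. SUP n. \<eta> n \<omega>) \<in> Lp M"
    by (rule Lp_AE_cong[OF V])
  have "AE \<omega> in M. ereal (\<rho> S \<nu> (V \<nu>) \<omega>) \<le> liminf (\<lambda>n. ereal (\<rho> S \<nu> (\<eta> n) \<omega>))"
    using \<eta> mono lim SUP_Lp unfolding \<eta>_def
    by (intro fatou[unfolded monotone_Fatou_def, THEN bspec, THEN bspec, THEN bspec, THEN spec,
        THEN mp] S \<nu>_Th value_Lp[OF op adm p_int zol val \<nu>_Th V]) auto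
  moreover have "AE \<omega> in M. \<forall>n. \<rho> S \<nu> (\<eta> n) \<omega> \<le> V S \<omega>"
    unfolding AE_all_countable
  proof
    fix n
    have "AE \<omega> in M. \<rho> S \<nu> (\<eta> n) \<omega> = \<rho> S (s n) (\<xi> (s n)) \<omega>"
      using con S \<nu> s xi_Lp[OF adm p_int s_Th] unfolding consistent_def \<eta>_def by blast
    then show "AE \<omega> in M. \<rho> S \<nu> (\<eta> n) \<omega> \<le> V S \<omega>"
      using rho_le_value[OF val S Theta_from_trans[OF \<nu> s]] by eventually_elim simp
  qed
  ultimately show ?thesis
  proof eventually_elim
    case (elim \<omega>)
    note elim(1)
    also have "liminf (\<lambda>n. ereal (\<rho> S \<nu> (\<eta> n) \<omega>)) \<le> liminf (\<lambda>n. ereal (V S \<omega>))"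
      using elim(2) by (intro Liminf_mono always_eventually) auto
    also have "\<dots> = ereal (V S \<omega>)"
      by (simp add: Liminf_const)
    finally show ?case by simp
  qed
qed

lemma rho_le_max:
  assumes op: "operator_family \<rho>" and adm: "admissible \<xi>" and p_int: "p_integrable \<xi>"
    and zol: "zero_one_law \<rho>" and val: "is_value_family \<rho> \<xi> V"
    and know: "knowledge_preserving \<rho>" and mono: "monotone_op \<rho>" and con: "consistent \<rho>"
    and V: "V (\<theta> (Suc k)) \<in> Lp M" and \<tau>: "\<tau> \<in> Theta_from (\<theta> k)"
  shows "AE \<omega> in M. \<rho> (\<theta> k) \<tau> (\<xi> \<tau>) \<omega> \<le>
    max (\<xi> (\<theta> k) \<omega>) (\<rho> (\<theta> k) (\<theta> (Suc k)) (V (\<theta> (Suc k))) \<omega>)"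
proof -
  let ?S = "\<theta> k" and ?S' = "\<theta> (Suc k)"
  note Th = theta_in_Theta[of k] theta_in_Theta[of "Suc k"]
  have \<tau>_Th: "\<tau> \<in> Theta" using \<tau> by (simp add: Theta_from_def)
  \<comment> \<open>On \<open>A\<close> stopping is immediate, so the zero-one law and knowledge
    preservation produce \<open>\<xi> (\<theta> k)\<close>.\<close>
  define A where "A = {\<omega> \<in> space M. ?S \<omega> = \<tau> \<omega>}"
  have A: "A \<in> sets (pre_sigma ?S)"
    unfolding A_def by (intro stopping_time_eq stopping_theta ThetaD(1)[OF \<tau>_Th])
  have "AE \<omega> in M. \<omega> \<in> A \<longrightarrow> \<rho> ?S \<tau> (\<xi> \<tau>) \<omega> = \<rho> ?S ?S (\<xi> ?S) \<omega>"
    by (rule zero_one_lawD[OF zol adm p_int Th(1) A \<tau> Theta_from_refl[OF Th(1)]])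
      (simp add: A_def)
  moreover have "AE \<omega> in M. \<rho> ?S ?S (\<xi> ?S) \<omega> = \<xi> ?S \<omega>"
    using know Th(1) Theta_from_refl xi_Lp[OF adm p_int] unfolding knowledge_preserving_def by blast
  \<comment> \<open>Raising \<open>\<tau>\<close> to the next date changes nothing a.s. outside
    \<open>A\<close>, and \<open>\<sigma>\<close> is a competitor for
    \<open>V (\<theta> (Suc k))\<close>. Consistency inserts the date
    \<open>\<theta> (Suc k)\<close>, and monotonicity replaces the inner term by the value.\<close>
  moreover define \<sigma> where "\<sigma> = (\<lambda>\<omega>. max (\<tau> \<omega>) (?S' \<omega>))"
  have \<sigma>_Th: "\<sigma> \<in> Theta"
    unfolding \<sigma>_def by (rule max_in_Theta[OF \<tau>_Th Th(2)])
  then have \<sigma>: "\<sigma> \<in> Theta_from ?S'"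
    by (simp add: Theta_from_def \<sigma>_def)
  have "AE \<omega> in M. \<omega> \<in> space (pre_sigma ?S) - A \<longrightarrow>
      \<rho> ?S \<tau> (\<xi> \<tau>) \<omega> = \<rho> ?S \<sigma> (\<xi> \<sigma>) \<omega>"
  proof (rule zero_one_lawD[OF zol adm p_int Th(1) _ \<tau> Theta_from_trans[OF Theta_from_theta_Suc \<sigma>]])
    show "AE \<omega> in M. \<omega> \<in> space (pre_sigma ?S) - A \<longrightarrow> \<tau> \<omega> = \<sigma> \<omega>"
      using Theta_from_theta_cases[OF \<tau>]
      by eventually_elim (auto simp: A_def \<sigma>_def space_pre_sigma)
  qed (use A in auto)
  moreover have "AE \<omega> in M. \<rho> ?S ?S' (\<rho> ?S' \<sigma> (\<xi> \<sigma>)) \<omega> = \<rho> ?S \<sigma> (\<xi> \<sigma>) \<omega>"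
    using con Th(1) Theta_from_theta_Suc \<sigma> xi_Lp[OF adm p_int \<sigma>_Th]
    unfolding consistent_def by blast
  moreover have "AE \<omega> in M. \<rho> ?S ?S' (\<rho> ?S' \<sigma> (\<xi> \<sigma>)) \<omega> \<le> \<rho> ?S ?S' (V ?S') \<omega>"
  proof -
    have "\<rho> ?S' \<sigma> (\<xi> \<sigma>) \<in> Lp (pre_sigma ?S')"
      using op xi_Lp[OF adm p_int \<sigma>_Th] \<sigma>_Th Th unfolding operator_family_def by blast
    then show ?thesis
      using mono Th value_Lp[OF op adm p_int zol val Th(2) V] rho_le_value[OF val Th(2) \<sigma>]
      unfolding monotone_op_def by blast
  qed
  ultimately show ?thesis
    using AE_space by eventually_elim (auto simp: space_pre_sigma)
qed

text \<open>The maximum bounds every member of the family by \<open>rho_le_max\<close>, hence also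
  its essential supremum. Conversely, immediate stopping at \<open>\<theta> k\<close> is a
  competitor, and the supermartingale property bounds the other term.\<close>

lemma value_theta:
  assumes op: "operator_family \<rho>" and adm: "admissible \<xi>" and p_int: "p_integrable \<xi>"
    and zol: "zero_one_law \<rho>" and val: "is_value_family \<rho> \<xi> V"
    and know: "knowledge_preserving \<rho>" and mono: "monotone_op \<rho>" and con: "consistent \<rho>"
    and fatou: "monotone_Fatou \<rho>" and V: "V (\<theta> (Suc k)) \<in> Lp M"
  shows "AE \<omega> in M. V (\<theta> k) \<omega> =
    max (\<xi> (\<theta> k) \<omega>) (\<rho> (\<theta> k) (\<theta> (Suc k)) (V (\<theta> (Suc k))) \<omega>)"
proof -
  let ?S = "\<theta> k" and ?S' = "\<theta> (Suc k)"
  note Th = theta_in_Theta[of k] theta_in_Theta[of "Suc k"]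
  have \<xi>: "\<xi> ?S \<in> Lp (pre_sigma ?S)"
    by (rule xi_Lp[OF adm p_int Th(1)])
  have "\<rho> ?S ?S' (V ?S') \<in> Lp (pre_sigma ?S)"
    using op Th value_Lp[OF op adm p_int zol val Th(2) V] unfolding operator_family_def by blast
  with \<xi> have [measurable]: "\<xi> ?S \<in> borel_measurable M" "\<rho> ?S ?S' (V ?S') \<in> borel_measurable M"
    using measurable_pre_sigma_M[OF Th(1)] by (auto simp: Lp_def)
  have "AE \<omega> in M. V ?S \<omega> \<le> max (\<xi> ?S \<omega>) (\<rho> ?S ?S' (V ?S') \<omega>)"
    by (rule value_le[OF val Th(1) _ rho_le_max[OF op adm p_int zol val know mono con V]])
      measurable
  moreover have "AE \<omega> in M. \<rho> ?S ?S (\<xi> ?S) \<omega> = \<xi> ?S \<omega>"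
    using know Th(1) Theta_from_refl \<xi> unfolding knowledge_preserving_def by blast
  moreover have "AE \<omega> in M. \<rho> ?S ?S (\<xi> ?S) \<omega> \<le> V ?S \<omega>"
    by (rule rho_le_value[OF val Th(1) Theta_from_refl[OF Th(1)]])
  moreover have "AE \<omega> in M. \<rho> ?S ?S' (V ?S') \<omega> \<le> V ?S \<omega>"
    by (rule rho_value_le_value[OF op adm p_int zol val con fatou Th(1) Theta_from_theta_Suc V])
  ultimately show ?thesis
    by eventually_elim auto
qed

text \<open>No time in \<open>Theta\<close> exceeds \<open>T\<close>, so every competitor from
  \<open>T\<close> on equals \<open>T\<close> a.s. and the whole family collapses to
  \<open>\<xi> (\<lambda>_. T)\<close>.\<close>

lemma value_T:
  assumes adm: "admissible \<xi>" and p_int: "p_integrable \<xi>"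
    and val: "is_value_family \<rho> \<xi> V" and know: "knowledge_preserving \<rho>"
  shows "AE \<omega> in M. V (\<lambda>_. T) \<omega> = \<xi> (\<lambda>_. T) \<omega>"
proof -
  let ?T = "\<lambda>_::'a. T"
  have eq: "AE \<omega> in M. \<rho> ?T \<tau> (\<xi> \<tau>) \<omega> = \<xi> ?T \<omega>" if \<tau>: "\<tau> \<in> Theta_from ?T" for \<tau>
  proof -
    have \<tau>_Th: "\<tau> \<in> Theta" and "AE \<omega> in M. T \<le> \<tau> \<omega>"
      using \<tau> by (auto simp: Theta_from_def)
    from this(2) AE_space have "AE \<omega> in M. \<tau> \<omega> = T"
      by eventually_elim (use ThetaD(3)[OF \<tau>_Th] in force)
    moreover have "AE \<omega> in M. \<tau> \<omega> = T \<longrightarrow> \<xi> \<tau> \<omega> = \<xi> ?T \<omega>"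
      using adm \<tau>_Th T_in_Theta unfolding admissible_def by fast
    \<comment> \<open>Knowledge preservation concerns \<open>\<rho>\<close> with the later time as
      first index, so the ordering needed here is \<open>\<tau> \<omega> \<le> T\<close>.\<close>
    moreover have "?T \<in> Theta_from \<tau>"
      using ThetaD(3)[OF \<tau>_Th] T_in_Theta by (simp add: Theta_from_def)
    then have "AE \<omega> in M. \<rho> ?T \<tau> (\<xi> \<tau>) \<omega> = \<xi> \<tau> \<omega>"
      using know \<tau>_Th xi_Lp[OF adm p_int \<tau>_Th] unfolding knowledge_preserving_def by blast
    ultimately show ?thesis by eventually_elim simp
  qed
  have "\<xi> ?T \<in> borel_measurable M"
    using adm T_in_Theta measurable_pre_sigma_M unfolding admissible_def by blast
  then have "AE \<omega> in M. V ?T \<omega> \<le> \<xi> ?T \<omega>"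
    by (rule value_le[OF val T_in_Theta]) (rule eventually_mono[OF eq], auto)
  then show ?thesis
    using rho_le_value[OF val T_in_Theta Theta_from_refl[OF T_in_Theta]]
      eq[OF Theta_from_refl[OF T_in_Theta]]
    by eventually_elim simp
qed

end

theorem theorem2p2:
  fixes M :: "'a measure" and F :: "real \<Rightarrow> 'a measure" and T :: real
    and \<theta> :: "nat \<Rightarrow> 'a \<Rightarrow> real" and p :: ennreal
    and \<rho> :: "('a \<Rightarrow> real) \<Rightarrow> ('a \<Rightarrow> real) \<Rightarrow> ('a \<Rightarrow> real) \<Rightarrow> 'a \<Rightarrow> real"
    and \<xi> V :: "('a \<Rightarrow> real) \<Rightarrow> 'a \<Rightarrow> real"
  assumes "bermudan M F T \<theta> p"
    and "bermudan.operator_family M F T \<theta> p \<rho>"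
    and "bermudan.admissible M F T \<theta> \<xi>"
    and "bermudan.p_integrable M F T \<theta> p \<xi>"
    and "bermudan.is_value_family M F T \<theta> \<rho> \<xi> V"
    and "\<forall>\<nu>\<in>bermudan.Theta M F T \<theta>. V \<nu> \<in> bermudan.Lp M p M"
    and "bermudan.knowledge_preserving M F T \<theta> p \<rho>"
    and "bermudan.monotone_op M F T \<theta> p \<rho>"
    and "bermudan.consistent M F T \<theta> p \<rho>"
    and "bermudan.zero_one_law M F T \<theta> p \<rho>"
    and "bermudan.monotone_Fatou M F T \<theta> p \<rho>"
  shows "(\<forall>k. AE \<omega> in M. V (\<theta> k) \<omega> =
            max (\<xi> (\<theta> k) \<omega>) (\<rho> (\<theta> k) (\<theta> (Suc k)) (V (\<theta> (Suc k))) \<omega>))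
       \<and> (AE \<omega> in M. V (\<lambda>_. T) \<omega> = \<xi> (\<lambda>_. T) \<omega>)"
proof -
  interpret bermudan M F T \<theta> p by fact
  show ?thesis
    using value_theta[OF assms(2-4,10,5,7-9,11)] value_T[OF assms(3-5,7)] assms(6) theta_in_Theta
    by blast
qed

end
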